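(* Let $L$ be a frame and let $\{(a_i,b_i)\}_{i\in I}\subseteq\mathsf{LC}(L)$. Then $\{(a_i,b_i)\}_{i\in I}$ is locally exact if and only if the family $\{(a_i,b_i)\}_{i\in I}$ is admissible in the join-semilattice $\mathsf{LC}(L)$.
   Context: For a frame $L$ with Heyting implication $\to$, a sublocale of $L$ is a subset $S\subseteq L$ closed under arbitrary meets and such that $a\to s\in S$ for all $a\in L$, $s\in S$. The set $\mathsf{S}(L)$ of all sublocales, ordered by inclusion, is a coframe in which meets are intersections and $\bigvee_i S_i=\{\bigwedge N\mid N\subseteq\bigcup_i S_i\}$. For $a\in L$, the closed and open sublocales are $\mathfrak{c}(a)=\{b\in L\mid b\ge a\}$ and $\mathfrak{o}(a)=\{a\to b\mid b\in L\}$; they are complements of each other in $\mathsf{S}(L)$. A sublocale is locally closed if it is of the form $\mathfrak{c}(a)\cap\mathfrak{o}(b)$ with $a,b\in L$. Let $\mathsf{LC}(L)=\{(a,b)\in L\times L\mid a\le b,\ b\to a=a\}$, with the partial order $(x,y)\sqsubseteq(a,b)$ iff $x\le a$ and $b\le a\vee y$ (equivalently, $\mathfrak{c}(a)\cap\mathfrak{o}(b)\subseteq\mathfrak{c}(x)\cap\mathfrak{o}(y)$). This is a join-semilattice, anti-isomorphic to the poset of locally closed sublocales of $L$ via $(a,b)\mapsto\mathfrak{c}(a)\cap\mathfrak{o}(b)$. A family $\{(a_i,b_i)\}_{i\in I}\subseteq L\times L$ is locally exact if the sublocale $\bigvee_{i\in I}\bigl(\mathfrak{c}(a_i)\cap\mathfrak{o}(b_i)\bigr)$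 (join in $\mathsf{S}(L)$) is locally closed. In a join-semilattice $S$, a family $\{a_i\}_{i\in I}$ is admissible if its meet exists in $S$ and, for each $b\in S$, the meet $\bigwedge_{i}(b\vee a_i)$ exists and equals $b\vee\bigwedge_i a_i$. *)

theory Defs
  imports "HOL-Algebra.Lattice"
begin

(* HOL-Algebra reuses the names of the lattice class operations. Below, sup and inf
   are the operations of a type class; joins and meets in a carrier-based order S are
   written with a subscript, or expressed with is_glb. *)
hide_const (open) Lattice.sup Lattice.inf

(* The library's complete_distrib_lattice is complete distributivity, which is strictly
   stronger than the frame law. *)
class frame = complete_lattice +
  assumes inf_Sup_frame: "inf a (Sup A) = (SUP b\<in>A. inf a b)"

definition heyting_imp :: "'a::frame \<Rightarrow> 'a \<Rightarrow> 'a"  (infixr \<open>\<rightarrow>\<^sub>H\<close> 60)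
  where "a \<rightarrow>\<^sub>H b = Sup {c. inf c a \<le> b}"

lemma le_heyting_imp_iff: "c \<le> a \<rightarrow>\<^sub>H b \<longleftrightarrow> inf c a \<le> (b::'a::frame)"
proof
  assume "c \<le> a \<rightarrow>\<^sub>H b"
  then have "inf c a \<le> inf a (a \<rightarrow>\<^sub>H b)"
    by (simp add: le_infI1)
  also have "\<dots> \<le> b"
    unfolding heyting_imp_def inf_Sup_frame by (rule SUP_least) (simp add: inf.commute)
  finally show "inf c a \<le> b" .
next
  assume "inf c a \<le> b"
  then show "c \<le> a \<rightarrow>\<^sub>H b"
    unfolding heyting_imp_def by (simp add: Sup_upper)
qed

lemma inf_sup_distrib_frame:
  "inf a (sup b c) = sup (inf a b) (inf a (c::'a::frame))"
  using inf_Sup_frame[of a "{b, c}"] by simp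

lemma sup_inf_distrib_frame:
  "sup a (inf b c) = inf (sup a b) (sup a (c::'a::frame))"
  by (rule distrib_imp1) (rule inf_sup_distrib_frame)

definition is_sublocale :: "'a::frame set \<Rightarrow> bool"
  where "is_sublocale S \<longleftrightarrow>
    (\<forall>A. A \<subseteq> S \<longrightarrow> Inf A \<in> S) \<and> (\<forall>a. \<forall>s\<in>S. a \<rightarrow>\<^sub>H s \<in> S)"

definition sublocales :: "'a::frame set gorder"
  where "sublocales = \<lparr>carrier = {S. is_sublocale S}, eq = (=), le = (\<subseteq>)\<rparr>"

definition closed_sublocale :: "'a::frame \<Rightarrow> 'a set"  (\<open>\<cc>\<close>)
  where "\<cc> a = {b. a \<le> b}"

definition open_sublocale :: "'a::frame \<Rightarrow> 'a set"  (\<open>\<oo>\<close>)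
  where "\<oo> a = {a \<rightarrow>\<^sub>H b | b. True}"

definition locally_closed :: "'a::frame set \<Rightarrow> bool"
  where "locally_closed S \<longleftrightarrow> (\<exists>a b. S = \<cc> a \<inter> \<oo> b)"

(* SSUP is the least upper bound in the poset of sublocales, not a union of sets;
   see supr_sublocales for its explicit description. *)
definition locally_exact :: "'i set \<Rightarrow> ('i \<Rightarrow> 'a::frame \<times> 'a) \<Rightarrow> bool"
  where "locally_exact I f \<longleftrightarrow>
    locally_closed (SSUP\<^bsub>sublocales\<^esub> i:I. \<cc> (fst (f i)) \<inter> \<oo> (snd (f i)))"

lemma heyting_imp_Inf: "a \<rightarrow>\<^sub>H Inf N = (INF n\<in>N. a \<rightarrow>\<^sub>H (n::'a::frame))"
proof -
  have "x \<le> a \<rightarrow>\<^sub>H Inf N \<longleftrightarrow> x \<le> (INF n\<in>N. a \<rightarrow>\<^sub>H n)" for x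
    by (simp add: le_heyting_imp_iff le_Inf_iff)
  then show ?thesis by (meson order_antisym order_refl)
qed

lemma heyting_imp_inf: "a \<rightarrow>\<^sub>H b \<rightarrow>\<^sub>H c = inf a b \<rightarrow>\<^sub>H (c::'a::frame)"
proof -
  have "x \<le> a \<rightarrow>\<^sub>H b \<rightarrow>\<^sub>H c \<longleftrightarrow> x \<le> inf a b \<rightarrow>\<^sub>H c" for x
    by (simp add: le_heyting_imp_iff inf.assoc)
  then show ?thesis by (meson order_antisym order_refl)
qed

lemma is_sublocale_closed: "is_sublocale (\<cc> a)"
  by (auto simp: is_sublocale_def closed_sublocale_def le_heyting_imp_iff le_Inf_iff
      intro: le_infI1)

lemma open_sublocale_iff: "x \<in> \<oo> a \<longleftrightarrow> a \<rightarrow>\<^sub>H x = x"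
  by (auto simp: open_sublocale_def heyting_imp_inf) metis

lemma is_sublocale_open: "is_sublocale (\<oo> a)"
proof -
  have "a \<rightarrow>\<^sub>H Inf N = Inf N" if "N \<subseteq> \<oo> a" for N
    using that by (simp add: heyting_imp_Inf subset_iff open_sublocale_iff)
  moreover have "a \<rightarrow>\<^sub>H b \<rightarrow>\<^sub>H s = b \<rightarrow>\<^sub>H s" if "s \<in> \<oo> a" for b s
    using that by (metis heyting_imp_inf inf.commute open_sublocale_iff)
  ultimately show ?thesis
    by (simp add: is_sublocale_def open_sublocale_iff)
qed

lemma is_sublocale_Int: "is_sublocale S \<Longrightarrow> is_sublocale T \<Longrightarrow> is_sublocale (S \<inter> T)"
  by (simp add: is_sublocale_def)

lemma partial_order_sublocales: "partial_order sublocales"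
  by unfold_locales (auto simp: sublocales_def)

lemma supr_sublocales:
  assumes "\<And>i. i \<in> I \<Longrightarrow> is_sublocale (S i)"
  shows "(SSUP\<^bsub>sublocales\<^esub> i:I. S i) = {Inf N | N. N \<subseteq> (\<Union>i\<in>I. S i)}" (is "_ = ?J")
proof -
  let ?U = "\<Union>i\<in>I. S i"
  have sub: "S i \<subseteq> ?J" if "i \<in> I" for i
  proof
    fix x assume "x \<in> S i"
    then have "x = Inf {x} \<and> {x} \<subseteq> ?U" using that by auto
    then show "x \<in> ?J" by blast
  qed
  have "is_sublocale ?J"
    unfolding is_sublocale_def
  proof (intro conjI allI impI ballI)
    fix A assume A: "A \<subseteq> ?J"
    have "Inf A = Inf (\<Union>a\<in>A. {n \<in> ?U. a \<le> n})"
    proof (rule order_antisym)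
      show "Inf A \<le> Inf (\<Union>a\<in>A. {n \<in> ?U. a \<le> n})"
        by (rule Inf_greatest) (auto intro: Inf_lower2)
      show "Inf (\<Union>a\<in>A. {n \<in> ?U. a \<le> n}) \<le> Inf A"
      proof (rule Inf_greatest)
        fix a assume a: "a \<in> A"
        then obtain N where N: "a = Inf N" "N \<subseteq> ?U" using A by blast
        then have "N \<subseteq> {n \<in> ?U. a \<le> n}" by (auto intro: Inf_lower)
        then show "Inf (\<Union>a\<in>A. {n \<in> ?U. a \<le> n}) \<le> a"
          using a unfolding N(1) by (intro Inf_superset_mono) blast
      qed
    qed
    moreover have "(\<Union>a\<in>A. {n \<in> ?U. a \<le> n}) \<subseteq> ?U" by blast
    ultimately show "Inf A \<in> ?J" by blast
  next
    fix a s assume "s \<in> ?J"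
    then obtain N where N: "s = Inf N" "N \<subseteq> ?U" by blast
    have "(\<rightarrow>\<^sub>H) a ` N \<subseteq> ?U" using N(2) assms by (fastforce simp: is_sublocale_def)
    then show "a \<rightarrow>\<^sub>H s \<in> ?J" unfolding N(1) heyting_imp_Inf by blast
  qed
  moreover have "?J \<subseteq> T" if "is_sublocale T" "\<forall>i\<in>I. S i \<subseteq> T" for T
    using that unfolding is_sublocale_def by blast
  ultimately have "least sublocales ?J (Upper sublocales (S ` I))"
    using sub assms by (auto simp: least_def Upper_def sublocales_def)
  then have "x = ?J" if "least sublocales x (Upper sublocales (S ` I))" for x
    using that partial_order.least_unique[OF partial_order_sublocales] by blast
  with \<open>least sublocales ?J _\<close> show ?thesis
    unfolding supr_def Lattice.sup_def by (rule someI2)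
qed

(* The order is dual to inclusion of the sublocales represented by the pairs. *)
definition LC :: "('a::frame \<times> 'a) gorder"
  where "LC = \<lparr>carrier = {(a, b). a \<le> b \<and> b \<rightarrow>\<^sub>H a = a}, eq = (=),
    le = (\<lambda>(x, y) (a, b). x \<le> a \<and> b \<le> sup a y)\<rparr>"

lemma partial_order_LC: "partial_order (LC :: ('a::frame \<times> 'a) gorder)"
proof -
  have trans: "x \<le> u \<and> v \<le> sup u y"
    if "x \<le> a" "b \<le> sup a y" "a \<le> u" "v \<le> sup u b" for x y a b u v :: 'a
  proof -
    have "v \<le> sup u (sup a y)" using that by (meson order_trans order_refl sup.mono)
    then show ?thesis using that by (simp add: sup_absorb1 flip: sup_assoc)
  qed
  have antisym: "x = a \<and> y = b"
    if "x \<le> a" "b \<le> sup a y" "a \<le> x" "y \<le> sup x b" "x \<le> y" "a \<le> b" for x y a b :: 'a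
    using that by (metis order_antisym sup_absorb2)
  show ?thesis
  proof
    fix p q r :: "'a \<times> 'a"
    assume pqr: "p \<sqsubseteq>\<^bsub>LC\<^esub> q" "q \<sqsubseteq>\<^bsub>LC\<^esub> r"
    obtain x y a b u v where [simp]: "p = (x, y)" "q = (a, b)" "r = (u, v)"
      by (meson surj_pair)
    show "p \<sqsubseteq>\<^bsub>LC\<^esub> r"
      using pqr trans[of x a b y u v] by (simp add: LC_def)
  next
    fix p q :: "'a \<times> 'a"
    assume pq: "p \<sqsubseteq>\<^bsub>LC\<^esub> q" "q \<sqsubseteq>\<^bsub>LC\<^esub> p" "p \<in> carrier LC" "q \<in> carrier LC"
    obtain x y a b where [simp]: "p = (x, y)" "q = (a, b)"
      by (meson surj_pair)
    show "p .=\<^bsub>LC\<^esub> q"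
      using pq antisym[of x a b y] by (simp add: LC_def)
  qed (auto simp: LC_def)
qed

lemma upper_semilattice_LC: "upper_semilattice (LC :: ('a::frame \<times> 'a) gorder)"
proof -
  interpret partial_order "LC :: ('a \<times> 'a) gorder" by (rule partial_order_LC)
  show ?thesis
  proof
    fix p q :: "'a \<times> 'a"
    assume pq: "p \<in> carrier LC" "q \<in> carrier LC"
    obtain a b a' b' where [simp]: "p = (a, b)" "q = (a', b')" by fastforce
    define c where "c = inf b b' \<rightarrow>\<^sub>H sup a a'"
    define d where "d = sup (inf b b') c"
    have ac: "sup a a' \<le> c" by (simp add: c_def le_heyting_imp_iff le_infI1)
    have "inf (d \<rightarrow>\<^sub>H c) (inf b b') \<le> sup a a'"
    proof -
      have "inf (d \<rightarrow>\<^sub>H c) (inf b b') \<le> inf (d \<rightarrow>\<^sub>H c) d"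
        unfolding d_def by (rule inf_mono) auto
      also have "\<dots> \<le> c" by (simp flip: le_heyting_imp_iff)
      finally have "inf (inf (d \<rightarrow>\<^sub>H c) (inf b b')) (inf b b') \<le> sup a a'"
        unfolding c_def le_heyting_imp_iff .
      then show ?thesis by (simp add: inf.assoc)
    qed
    then have "d \<rightarrow>\<^sub>H c \<le> c" by (simp add: c_def le_heyting_imp_iff)
    then have "d \<rightarrow>\<^sub>H c = c"
      by (intro order_antisym) (auto simp: le_heyting_imp_iff le_infI1)
    then have car: "(c, d) \<in> carrier LC" by (simp add: LC_def d_def)
    have ub: "(c, d) \<in> Upper LC {p, q}"
      using ac car by (auto simp: Upper_def LC_def d_def le_supI2 le_supI1 le_infI1 le_infI2)
    have "(c, d) \<sqsubseteq>\<^bsub>LC\<^esub> r" if "r \<in> Upper LC {p, q}" for r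
    proof -
      obtain u v where r: "r = (u, v)" by fastforce
      have *: "a \<le> u" "a' \<le> u" "v \<le> sup u b" "v \<le> sup u b'" "v \<rightarrow>\<^sub>H u = u"
        using that pq by (auto simp: Upper_def LC_def r)
      then have v: "v \<le> sup u (inf b b')" by (simp add: sup_inf_distrib_frame)
      have "inf c v \<le> inf c (sup u (inf b b'))" using v by (simp add: le_infI2)
      also have "\<dots> = sup (inf c u) (inf c (inf b b'))" by (rule inf_sup_distrib_frame)
      also have "inf c (inf b b') \<le> sup a a'" by (simp add: c_def flip: le_heyting_imp_iff)
      then have "sup (inf c u) (inf c (inf b b')) \<le> u"
        using *(1,2) by (meson inf_le2 le_sup_iff order_trans sup_least)
      finally have "c \<le> u" using *(5) by (metis le_heyting_imp_iff)
      moreover have "v \<le> sup u d"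
        using v unfolding d_def by (meson order_trans order_refl sup.mono sup_ge1)
      ultimately show ?thesis by (simp add: LC_def r)
    qed
    with ub show "\<exists>s. least LC s (Upper LC {p, q})"
      unfolding least_def by (meson Upper_closed)
  qed
qed

definition admissible :: "('a, 'b) gorder_scheme \<Rightarrow> 'i set \<Rightarrow> ('i \<Rightarrow> 'a) \<Rightarrow> bool"
  where "admissible S I f \<longleftrightarrow>
    (\<exists>m. is_glb S m (f ` I) \<and>
      (\<forall>b\<in>carrier S. is_glb S (b \<squnion>\<^bsub>S\<^esub> m) ((\<lambda>i. b \<squnion>\<^bsub>S\<^esub> f i) ` I)))"

end

theory Submission
  imports Defs
begin

text \<open>Via \<open>(a, b) \<mapsto> \<cc> a \<inter> \<oo> b\<close>, meets in \<open>LC\<close> are least locally closed upper bounds of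
  sublocales and joins are intersections. If the join \<open>J\<close> of the given sublocales is locally closed,
  it represents the meet, and admissibility holds because intersecting with a locally closed
  sublocale distributes over joins of sublocales. Conversely, let the meet be represented by
  \<open>M \<supseteq> J\<close>, and suppose \<open>s \<in> M - J\<close>. With \<open>t\<close> the least element of \<open>J\<close> above \<open>s\<close>,
  the locally closed sublocale \<open>T = \<cc> s \<inter> \<oo> t\<close> meets \<open>J\<close> trivially, so admissibility forces
  \<open>T \<inter> M\<close> to be trivial; but \<open>t \<rightarrow>\<^sub>H s\<close> is a nontrivial element of it.\<close>

hide_const (open) Order.top

section \<open>Identities for Heyting implication\<close>

lemma le_heyting_imp: "s \<le> a \<rightarrow>\<^sub>H (s::'a::frame)"
  by (simp add: le_heyting_imp_iff)

lemma heyting_imp_eq_top_iff: "a \<rightarrow>\<^sub>H b = top \<longleftrightarrow> a \<le> (b::'a::frame)"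
  using le_heyting_imp_iff[of top a b] by (simp add: top_unique)

lemma heyting_imp_mono: "b \<le> c \<Longrightarrow> a \<rightarrow>\<^sub>H b \<le> a \<rightarrow>\<^sub>H (c::'a::frame)"
  by (meson le_heyting_imp_iff order_refl order_trans)

lemma heyting_imp_idem: "a \<rightarrow>\<^sub>H a \<rightarrow>\<^sub>H b = a \<rightarrow>\<^sub>H (b::'a::frame)"
  by (simp add: heyting_imp_inf)

lemma heyting_sup_imp: "sup a b \<rightarrow>\<^sub>H c = inf (a \<rightarrow>\<^sub>H c) (b \<rightarrow>\<^sub>H (c::'a::frame))"
proof -
  have "x \<le> sup a b \<rightarrow>\<^sub>H c \<longleftrightarrow> x \<le> inf (a \<rightarrow>\<^sub>H c) (b \<rightarrow>\<^sub>H c)" for x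
    by (simp add: le_heyting_imp_iff inf_sup_distrib_frame)
  then show ?thesis by (meson order_antisym order_refl)
qed

section \<open>The order and joins of \<open>LC\<close> in terms of sublocales\<close>

definition locally_closed_of :: "'a::frame \<times> 'a \<Rightarrow> 'a set"
  where "locally_closed_of p = \<cc> (fst p) \<inter> \<oo> (snd p)"

lemma mem_locally_closed_of:
  "z \<in> locally_closed_of (a, b) \<longleftrightarrow> a \<le> z \<and> b \<rightarrow>\<^sub>H z = (z::'a::frame)"
  by (simp add: locally_closed_of_def closed_sublocale_def open_sublocale_iff)

lemma is_sublocale_locally_closed_of: "is_sublocale (locally_closed_of p)"
  by (simp add: locally_closed_of_def is_sublocale_Int is_sublocale_closed is_sublocale_open)

text \<open>Passing from \<open>(a, b)\<close> to \<open>(?x, sup b ?x)\<close> with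
  \<open>?x = b \<rightarrow>\<^sub>H a\<close> keeps the sublocale: an element above
  \<open>a\<close> and fixed by implication from \<open>b\<close> is above \<open>?x\<close>, and
  for \<open>z\<close> above \<open>?x\<close> the extra joinand contributes only
  \<open>?x \<rightarrow>\<^sub>H z = top\<close>.\<close>

lemma LC_representative:
  fixes a b :: "'a::frame"
  obtains p where "p \<in> carrier LC" "locally_closed_of p = \<cc> a \<inter> \<oo> b"
proof
  let ?x = "b \<rightarrow>\<^sub>H a"
  show "(?x, sup b ?x) \<in> carrier LC"
    by (simp add: LC_def heyting_sup_imp heyting_imp_idem inf_absorb1 le_heyting_imp)
  have "z \<in> locally_closed_of (?x, sup b ?x) \<longleftrightarrow> z \<in> locally_closed_of (a, b)" for z
  proof -
    have "?x \<le> z" if "a \<le> z" "b \<rightarrow>\<^sub>H z = z"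
      using heyting_imp_mono[OF that(1), of b] that(2) by simp
    moreover have "a \<le> z" if "?x \<le> z"
      using le_heyting_imp that by (rule order_trans)
    moreover have "sup b ?x \<rightarrow>\<^sub>H z = b \<rightarrow>\<^sub>H z" if "?x \<le> z"
      using that by (simp add: heyting_sup_imp flip: heyting_imp_eq_top_iff)
    ultimately show ?thesis
      unfolding mem_locally_closed_of by metis
  qed
  then show "locally_closed_of (?x, sup b ?x) = \<cc> a \<inter> \<oo> b"
    by (auto simp: locally_closed_of_def)
qed

lemma LC_le_iff:
  assumes q: "q \<in> carrier LC"
  shows "p \<sqsubseteq>\<^bsub>LC\<^esub> q \<longleftrightarrow> locally_closed_of q \<subseteq> locally_closed_of (p :: 'a::frame \<times> 'a)"
proof -
  obtain x y a b where [simp]: "p = (x, y)" "q = (a, b)" by fastforce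
  have "b \<rightarrow>\<^sub>H a = a" using q by (simp add: LC_def)
  then have aq: "a \<in> locally_closed_of (a, b)" by (simp add: mem_locally_closed_of)
  show ?thesis
  proof
    assume "p \<sqsubseteq>\<^bsub>LC\<^esub> q"
    then have le: "x \<le> a" "b \<le> sup a y" by (simp_all add: LC_def)
    show "locally_closed_of q \<subseteq> locally_closed_of p"
    proof
      fix z assume "z \<in> locally_closed_of q"
      then have z: "a \<le> z" "b \<rightarrow>\<^sub>H z = z" by (simp_all add: mem_locally_closed_of)
      let ?w = "y \<rightarrow>\<^sub>H z"
      \<comment> \<open>Both \<open>inf ?w y\<close> and \<open>inf ?w a\<close> lie below
        \<open>z\<close>, hence so does \<open>inf ?w b\<close>; as \<open>z\<close> is fixed by
        implication from \<open>b\<close>, this bounds \<open>?w\<close> itself.\<close>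
      have "inf ?w y \<le> z" by (simp flip: le_heyting_imp_iff)
      then have "inf ?w (sup a y) \<le> z"
        using z(1) by (simp add: inf_sup_distrib_frame le_infI2)
      then have "inf ?w b \<le> z" using le(2) by (meson inf_mono order_refl order_trans)
      then have "?w \<le> z" using z(2) by (simp flip: le_heyting_imp_iff)
      then show "z \<in> locally_closed_of p"
        using le(1) z(1) by (auto simp: mem_locally_closed_of le_heyting_imp order_antisym)
    qed
  next
    assume sub: "locally_closed_of q \<subseteq> locally_closed_of p"
    \<comment> \<open>A test element for the inclusion: since \<open>y\<close> is below
      \<open>?z\<close>, lying in \<open>\<oo> y\<close> forces \<open>?z = top\<close>, which says
      \<open>b \<le> sup a y\<close>.\<close>
    let ?z = "b \<rightarrow>\<^sub>H sup a y"
    have ay: "sup a y \<le> ?z" by (rule le_heyting_imp)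
    then have "?z \<in> locally_closed_of q"
      by (simp add: mem_locally_closed_of heyting_imp_idem)
    with sub have "y \<rightarrow>\<^sub>H ?z = ?z" by (auto simp: mem_locally_closed_of)
    moreover have "y \<rightarrow>\<^sub>H ?z = top" using ay by (simp add: heyting_imp_eq_top_iff)
    ultimately have "b \<le> sup a y" by (simp flip: heyting_imp_eq_top_iff)
    moreover have "x \<le> a" using aq sub by (auto simp: mem_locally_closed_of)
    ultimately show "p \<sqsubseteq>\<^bsub>LC\<^esub> q" by (simp add: LC_def)
  qed
qed

text \<open>The intersection is again locally closed, so some \<open>r\<close> in \<open>LC\<close>
  represents it. As the order reverses inclusion, \<open>r\<close> is an upper bound of
  \<open>p\<close> and \<open>q\<close>, and comparing it with the join needs no formula for the
  join.\<close>

lemma locally_closed_of_join: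
  fixes p q :: "'a::frame \<times> 'a"
  assumes p: "p \<in> carrier LC" and q: "q \<in> carrier LC"
  shows "locally_closed_of (p \<squnion>\<^bsub>LC\<^esub> q) = locally_closed_of p \<inter> locally_closed_of q"
proof -
  interpret upper_semilattice "LC :: ('a \<times> 'a) gorder" by (rule upper_semilattice_LC)
  obtain r where r: "r \<in> carrier LC"
    "locally_closed_of r = \<cc> (sup (fst p) (fst q)) \<inter> \<oo> (inf (snd p) (snd q))"
    by (rule LC_representative)
  \<comment> \<open>This is \<open>\<oo> (inf c d) = \<oo> c \<inter> \<oo> d\<close>.\<close>
  have "inf c d \<rightarrow>\<^sub>H z = z \<longleftrightarrow> c \<rightarrow>\<^sub>H z = z \<and> d \<rightarrow>\<^sub>H z = z" for c d z :: 'a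
    by (metis heyting_imp_inf heyting_imp_idem inf.commute)
  then have r_Int: "locally_closed_of r = locally_closed_of p \<inter> locally_closed_of q"
    unfolding r(2) by (auto simp: locally_closed_of_def closed_sublocale_def open_sublocale_iff)
  have "p \<squnion>\<^bsub>LC\<^esub> q \<sqsubseteq>\<^bsub>LC\<^esub> r"
    using p q r(1) r_Int by (intro join_le) (auto simp: LC_le_iff)
  then show ?thesis
    using p q r(1) r_Int join_left[OF p q] join_right[OF p q] by (auto simp: LC_le_iff)
qed

text \<open>Lower bounds correspond to locally closed sublocales containing every member of the
  family. The equivalence packs both halves of a greatest lower bound: \<open>r = m\<close> shows
  that \<open>m\<close> is a lower bound, and the direction from right to left shows that it is the
  greatest.\<close>

lemma is_glb_LC_iff:
  fixes m :: "'a::frame \<times> 'a"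
  assumes m: "m \<in> carrier LC" and g: "\<And>i. i \<in> I \<Longrightarrow> g i \<in> carrier LC"
  shows "is_glb LC m (g ` I) \<longleftrightarrow> (\<forall>r\<in>carrier LC.
    locally_closed_of m \<subseteq> locally_closed_of r \<longleftrightarrow>
      (\<forall>i\<in>I. locally_closed_of (g i) \<subseteq> locally_closed_of r))"
proof -
  have low: "r \<in> Lower LC (g ` I) \<longleftrightarrow>
      r \<in> carrier LC \<and> (\<forall>i\<in>I. locally_closed_of (g i) \<subseteq> locally_closed_of r)" for r
  proof -
    have "r \<in> Lower LC (g ` I) \<longleftrightarrow> r \<in> carrier LC \<and> (\<forall>i\<in>I. r \<sqsubseteq>\<^bsub>LC\<^esub> g i)"
      unfolding Lower_def using g by blast
    also have "\<dots> \<longleftrightarrow> r \<in> carrier LC \<and> (\<forall>i\<in>I. locally_closed_of (g i) \<subseteq> locally_closed_of r)"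
      by (simp add: LC_le_iff[OF g])
    finally show ?thesis .
  qed
  have "is_glb LC m (g ` I) \<longleftrightarrow>
      m \<in> Lower LC (g ` I) \<and> (\<forall>r\<in>Lower LC (g ` I). locally_closed_of m \<subseteq> locally_closed_of r)"
    unfolding greatest_def LC_le_iff[OF m] by (auto simp: Lower_def)
  then show ?thesis
    using m unfolding Ball_def[of "Lower _ _"] low by (meson subset_refl subset_trans)
qed

section \<open>Joins of sublocales, distributivity and separation\<close>

lemma join_sublocales_upper:
  assumes "\<And>i. i \<in> I \<Longrightarrow> is_sublocale (S i)" and "i \<in> I"
  shows "S i \<subseteq> (SSUP\<^bsub>sublocales\<^esub> i:I. (S i :: 'a::frame set))"
proof
  fix x assume "x \<in> S i"
  then have "x = Inf {x} \<and> {x} \<subseteq> (\<Union>i\<in>I. S i)" using assms(2) by auto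
  then have "x \<in> {Inf N | N. N \<subseteq> (\<Union>i\<in>I. S i)}" by blast
  also have "\<dots> = (SSUP\<^bsub>sublocales\<^esub> i:I. S i)"
    using assms(1) by (rule supr_sublocales[symmetric])
  finally show "x \<in> (SSUP\<^bsub>sublocales\<^esub> i:I. S i)" .
qed

lemma join_sublocales_le_iff:
  assumes S: "\<And>i. i \<in> I \<Longrightarrow> is_sublocale (S i)" and U: "is_sublocale U"
  shows "(SSUP\<^bsub>sublocales\<^esub> i:I. S i) \<subseteq> U \<longleftrightarrow> (\<forall>i\<in>I. S i \<subseteq> (U :: 'a::frame set))"
proof
  show "\<forall>i\<in>I. S i \<subseteq> U" if "(SSUP\<^bsub>sublocales\<^esub> i:I. S i) \<subseteq> U"
  proof
    fix i assume "i \<in> I"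
    then have "S i \<subseteq> (SSUP\<^bsub>sublocales\<^esub> i:I. S i)" by (intro join_sublocales_upper S)
    then show "S i \<subseteq> U" using that by (rule subset_trans)
  qed
  show "(SSUP\<^bsub>sublocales\<^esub> i:I. S i) \<subseteq> U" if "\<forall>i\<in>I. S i \<subseteq> U"
  proof -
    have "Inf N \<in> U" if "N \<subseteq> (\<Union>i\<in>I. S i)" for N
      using U that \<open>\<forall>i\<in>I. S i \<subseteq> U\<close> unfolding is_sublocale_def by blast
    then have "{Inf N | N. N \<subseteq> (\<Union>i\<in>I. S i)} \<subseteq> U" by blast
    moreover have "(SSUP\<^bsub>sublocales\<^esub> i:I. S i) = {Inf N | N. N \<subseteq> (\<Union>i\<in>I. S i)}"
      using S by (rule supr_sublocales)
    ultimately show ?thesis by simp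
  qed
qed

text \<open>Distributivity, tested against sublocales \<open>U\<close>. An element
  \<open>Inf N\<close> of the intersection is fixed by implication from \<open>b\<close>, so it is
  the meet of the elements \<open>b \<rightarrow>\<^sub>H n\<close>; each of these stays in the
  \<open>S i\<close> containing \<open>n\<close> and also lies in the locally closed
  sublocale.\<close>

lemma locally_closed_Int_join_sublocales_le_iff:
  fixes U :: "'a::frame set"
  assumes S: "\<And>i. i \<in> I \<Longrightarrow> is_sublocale (S i)" and U: "is_sublocale U"
  shows "locally_closed_of p \<inter> (SSUP\<^bsub>sublocales\<^esub> i:I. S i) \<subseteq> U \<longleftrightarrow>
    (\<forall>i\<in>I. locally_closed_of p \<inter> S i \<subseteq> U)"
proof
  assume le: "locally_closed_of p \<inter> (SSUP\<^bsub>sublocales\<^esub> i:I. S i) \<subseteq> U"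
  show "\<forall>i\<in>I. locally_closed_of p \<inter> S i \<subseteq> U"
  proof
    fix i assume "i \<in> I"
    then have "S i \<subseteq> (SSUP\<^bsub>sublocales\<^esub> i:I. S i)" by (intro join_sublocales_upper S)
    then show "locally_closed_of p \<inter> S i \<subseteq> U" using le by blast
  qed
next
  assume le: "\<forall>i\<in>I. locally_closed_of p \<inter> S i \<subseteq> U"
  obtain a b where [simp]: "p = (a, b)" by fastforce
  show "locally_closed_of p \<inter> (SSUP\<^bsub>sublocales\<^esub> i:I. S i) \<subseteq> U"
  proof
    fix z assume z: "z \<in> locally_closed_of p \<inter> (SSUP\<^bsub>sublocales\<^esub> i:I. S i)"
    moreover have "(SSUP\<^bsub>sublocales\<^esub> i:I. S i) = {Inf N | N. N \<subseteq> (\<Union>i\<in>I. S i)}"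
      using S by (rule supr_sublocales)
    ultimately obtain N where N: "z = Inf N" "N \<subseteq> (\<Union>i\<in>I. S i)" by auto
    have z': "a \<le> z" "b \<rightarrow>\<^sub>H z = z" using z by (simp_all add: mem_locally_closed_of)
    have "b \<rightarrow>\<^sub>H n \<in> U" if n: "n \<in> N" for n
    proof -
      obtain i where i: "i \<in> I" "n \<in> S i" using n N(2) by blast
      have "a \<le> n" using z'(1) n unfolding N(1) by (meson Inf_lower order_trans)
      then have "a \<le> b \<rightarrow>\<^sub>H n" using le_heyting_imp by (rule order_trans)
      then have "b \<rightarrow>\<^sub>H n \<in> locally_closed_of p"
        by (simp add: mem_locally_closed_of heyting_imp_idem)
      moreover have "b \<rightarrow>\<^sub>H n \<in> S i" using S[OF i(1)] i(2) by (simp add: is_sublocale_def)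
      ultimately show ?thesis using le i(1) by blast
    qed
    then have "(\<lambda>n. b \<rightarrow>\<^sub>H n) ` N \<subseteq> U" by blast
    then have "(INF n\<in>N. b \<rightarrow>\<^sub>H n) \<in> U"
      using U by (simp add: is_sublocale_def)
    then show "z \<in> U" using z'(2) unfolding N(1) by (simp add: heyting_imp_Inf)
  qed
qed

lemma locally_closed_iff_LC: "locally_closed S \<longleftrightarrow> (\<exists>p\<in>carrier LC. S = locally_closed_of p)"
  unfolding locally_closed_def by (metis LC_representative locally_closed_of_def)

text \<open>Here \<open>U\<close> is only a generating set. Its elements above \<open>s\<close> are
  above \<open>t\<close>, so the only one of them that can lie in \<open>\<oo> t\<close> is
  \<open>top\<close>, whereas \<open>t \<rightarrow>\<^sub>H s\<close> differs from
  \<open>top\<close> because \<open>s\<close> is strictly below \<open>t\<close>.\<close>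

lemma locally_closed_separation:
  fixes U M :: "'a::frame set"
  assumes M: "is_sublocale M" and ne: "\<not> M \<subseteq> {Inf N | N. N \<subseteq> U}"
  obtains p where "p \<in> carrier LC" "locally_closed_of p \<inter> U \<subseteq> {top}"
    "\<not> locally_closed_of p \<inter> M \<subseteq> {top}"
proof -
  obtain s where s: "s \<in> M" "\<And>N. N \<subseteq> U \<Longrightarrow> s \<noteq> Inf N" using ne by blast
  define t where "t = Inf {u \<in> U. s \<le> u}"
  have st: "s \<le> t" unfolding t_def by (auto intro: Inf_greatest)
  \<comment> \<open>Otherwise \<open>s\<close> would be a meet of elements of \<open>U\<close>. If
    nothing in \<open>U\<close> is above \<open>s\<close>, then \<open>t = top\<close>.\<close>
  have "s \<noteq> t" unfolding t_def by (rule s(2)) blast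
  obtain p where p: "p \<in> carrier LC" "locally_closed_of p = \<cc> s \<inter> \<oo> t"
    by (rule LC_representative)
  show thesis
  proof
    have "z = top" if "z \<in> U" "s \<le> z" "t \<rightarrow>\<^sub>H z = z" for z
    proof -
      have "t \<le> z" using that(1,2) unfolding t_def by (auto intro: Inf_lower)
      then show ?thesis using that(3) by (simp flip: heyting_imp_eq_top_iff)
    qed
    then show "locally_closed_of p \<inter> U \<subseteq> {top}"
      unfolding p(2) by (auto simp: closed_sublocale_def open_sublocale_iff)
    have "t \<rightarrow>\<^sub>H s \<in> locally_closed_of p \<inter> M"
      using M s(1) unfolding p(2)
      by (simp add: closed_sublocale_def open_sublocale_iff heyting_imp_idem le_heyting_imp
          is_sublocale_def)
    moreover have "t \<rightarrow>\<^sub>H s \<noteq> top"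
      using st \<open>s \<noteq> t\<close> by (auto simp: heyting_imp_eq_top_iff dest: order_antisym)
    ultimately show "\<not> locally_closed_of p \<inter> M \<subseteq> {top}" by blast
  qed (rule p(1))
qed

theorem corollary4p3:
  fixes I :: "'i set" and f :: "'i \<Rightarrow> 'a::frame \<times> 'a"
  assumes "\<And>i. i \<in> I \<Longrightarrow> f i \<in> carrier LC"
  shows "locally_exact I f \<longleftrightarrow> admissible LC I f"
proof -
  interpret upper_semilattice "LC :: ('a \<times> 'a) gorder" by (rule upper_semilattice_LC)
  define J where "J = (SSUP\<^bsub>sublocales\<^esub> i:I. locally_closed_of (f i))"
  have exact: "locally_exact I f \<longleftrightarrow> (\<exists>m\<in>carrier LC. J = locally_closed_of m)"
    unfolding locally_exact_def J_def locally_closed_iff_LC by (simp add: locally_closed_of_def)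
  have J_le: "J \<subseteq> locally_closed_of r \<longleftrightarrow> (\<forall>i\<in>I. locally_closed_of (f i) \<subseteq> locally_closed_of r)" for r
    unfolding J_def by (intro join_sublocales_le_iff is_sublocale_locally_closed_of)
  have Int_J_le: "locally_closed_of p \<inter> J \<subseteq> locally_closed_of r \<longleftrightarrow>
      (\<forall>i\<in>I. locally_closed_of p \<inter> locally_closed_of (f i) \<subseteq> locally_closed_of r)" for p r
    unfolding J_def
    by (intro locally_closed_Int_join_sublocales_le_iff is_sublocale_locally_closed_of)
  \<comment> \<open>Distributivity turns the condition on the family of joins into a comparison of
    two sets, with \<open>m\<close> and \<open>J\<close> in the same position.\<close>
  have glb_join: "is_glb LC (p \<squnion>\<^bsub>LC\<^esub> m) ((\<lambda>i. p \<squnion>\<^bsub>LC\<^esub> f i) ` I) \<longleftrightarrow>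
      (\<forall>r\<in>carrier LC. locally_closed_of p \<inter> locally_closed_of m \<subseteq> locally_closed_of r \<longleftrightarrow>
        locally_closed_of p \<inter> J \<subseteq> locally_closed_of r)"
    if "p \<in> carrier LC" "m \<in> carrier LC" for p m
    using that assms by (simp add: is_glb_LC_iff locally_closed_of_join Int_J_le)
  have glb: "is_glb LC m (f ` I) \<longleftrightarrow>
      (\<forall>r\<in>carrier LC. locally_closed_of m \<subseteq> locally_closed_of r \<longleftrightarrow> J \<subseteq> locally_closed_of r)"
    if "m \<in> carrier LC" for m
    unfolding J_le using that assms by (rule is_glb_LC_iff)
  show ?thesis
  proof
    assume "locally_exact I f"
    then obtain m where m: "m \<in> carrier LC" "J = locally_closed_of m" unfolding exact by blast
    show "admissible LC I f"
      unfolding admissible_def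
    proof (intro exI conjI ballI)
      show "is_glb LC m (f ` I)" unfolding glb[OF m(1)] m(2) by simp
      show "is_glb LC (p \<squnion>\<^bsub>LC\<^esub> m) ((\<lambda>i. p \<squnion>\<^bsub>LC\<^esub> f i) ` I)"
        if "p \<in> carrier LC" for p unfolding glb_join[OF that m(1)] m(2) by simp
    qed
  next
    assume "admissible LC I f"
    then obtain m where m: "is_glb LC m (f ` I)"
      and adm: "\<And>p. p \<in> carrier LC \<Longrightarrow> is_glb LC (p \<squnion>\<^bsub>LC\<^esub> m) ((\<lambda>i. p \<squnion>\<^bsub>LC\<^esub> f i) ` I)"
      unfolding admissible_def by blast
    have mc: "m \<in> carrier LC" using m by (auto simp: greatest_def Lower_def)
    \<comment> \<open>The criterion for the meet is instantiated at \<open>r = m\<close>.\<close>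
    have "J \<subseteq> locally_closed_of m" using bspec[OF m[unfolded glb[OF mc]] mc] by simp
    moreover have "locally_closed_of m \<subseteq> J"
    proof (rule ccontr)
      assume "\<not> locally_closed_of m \<subseteq> J"
      moreover have "J = {Inf N | N. N \<subseteq> (\<Union>i\<in>I. locally_closed_of (f i))}"
        unfolding J_def using is_sublocale_locally_closed_of by (rule supr_sublocales)
      ultimately have "\<not> locally_closed_of m \<subseteq> {Inf N | N. N \<subseteq> (\<Union>i\<in>I. locally_closed_of (f i))}"
        by simp
      then obtain p where p: "p \<in> carrier LC"
        "locally_closed_of p \<inter> (\<Union>i\<in>I. locally_closed_of (f i)) \<subseteq> {top}"
        "\<not> locally_closed_of p \<inter> locally_closed_of m \<subseteq> {top}"
        by (rule locally_closed_separation[OF is_sublocale_locally_closed_of])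
      \<comment> \<open>Admissibility speaks only of locally closed \<open>r\<close>, so the least
        sublocale \<open>{top}\<close> has to be represented in \<open>LC\<close> before triviality
        can be tested.\<close>
      obtain r where "r \<in> carrier LC" "locally_closed_of r = \<cc> (top :: 'a) \<inter> \<oo> top"
        by (rule LC_representative)
      then have r: "r \<in> carrier LC" "locally_closed_of r = {top :: 'a}"
        by (auto simp: closed_sublocale_def open_sublocale_iff top_unique heyting_imp_eq_top_iff)
      have "locally_closed_of p \<inter> J \<subseteq> locally_closed_of r"
        unfolding Int_J_le
      proof
        fix i assume "i \<in> I"
        then have "locally_closed_of p \<inter> locally_closed_of (f i) \<subseteq>
            locally_closed_of p \<inter> (\<Union>i\<in>I. locally_closed_of (f i))"
          by (intro Int_mono order_refl UN_upper)
        also note p(2)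
        finally show "locally_closed_of p \<inter> locally_closed_of (f i) \<subseteq> locally_closed_of r"
          unfolding r(2) .
      qed
      \<comment> \<open>Admissibility at \<open>p\<close> transfers the bound \<open>{top}\<close>
        from \<open>J\<close> to \<open>m\<close>.\<close>
      then have "locally_closed_of p \<inter> locally_closed_of m \<subseteq> locally_closed_of r"
        using bspec[OF adm[OF p(1), unfolded glb_join[OF p(1) mc]] r(1)] by simp
      then show False using p(3) r(2) by simp
    qed
    ultimately show "locally_exact I f" using mc unfolding exact by blast
  qed
qed

end
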